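(* Let $R$ be a unital commutative ring and let $(C_k,\,d^+_i,\,d^-_i)$ be a pre-cubical structure in the category $\mathbf{Mod}_R$ of $R$-modules. (1) For any $\alpha,\beta\in R$, the $R$-modules $C_k$ ($k\geqslant 0$) endowed with the maps $$\partial^{(\alpha,\beta)}_k=\alpha\sum_{i=1}^k(-1)^{i-1}d^+_i+\beta\sum_{i=1}^k(-1)^{i-1}d^-_i\colon C_k\to C_{k-1}$$ form a chain complex. (2) If the boundaries $(d^+_i,d^-_i)$ can be completed with degeneracies $s_i$ (so that $(C_k,d^+_i,d^-_i,s_i)$ is a weak skew cubical structure), then the submodules $C^{\mathrm D}_k=\sum_{i=1}^{k-1}\operatorname{Im}(s_i\colon C_{k-1}\to C_k)$ form a sub-complex of $(C_k,\partial^{(\alpha,\beta)}_k)$ for any $\alpha,\beta\in R$. (3) If the structure $(C_k,d^+_i,d^-_i,s_i)$ is moreover semi-strong skew cubical, then one has $R$-module decompositions $$C_k=C^{\mathrm D}_k\oplus C^{\mathrm N}_k,\qquad C^{\mathrm N}_k=\operatorname{Im}\eta_k,\qquad \eta_k=(\mathrm{Id}-s_1d^+_2)(\mathrm{Id}-s_2d^+_3)\cdots(\mathrm{Id}-s_{k-1}d^+_k),$$ and these yield a chain complex splitting of $(C_k,\partial^{(\alpha,\beta)}_k)$ for any $\alpha,\beta\in R$ (i.e. both $C^{\mathrm D}_\bullet$ and $C^{\mathrm N}_\bullet$ are sub-complexes).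
   Context: A pre-cubical structure in a category consists of objects $C_k$, $k\geqslant0$, and morphisms $d^+_i,d^-_i\colon C_k\to C_{k-1}$ for $k\geqslant1$, $1\leqslant i\leqslant k$ (boundaries), satisfying $d^\varepsilon_id^\zeta_j=d^\zeta_{j-1}d^\varepsilon_i$ for all $i<j$ and $\varepsilon,\zeta\in\{+,-\}$. It is weak skew cubical if it also includes morphisms $s_i\colon C_k\to C_{k+1}$ for $k\geqslant1$, $1\leqslant i\leqslant k$ (degeneracies), such that for both $\varepsilon\in\{+,-\}$: $d^\varepsilon_is_j=s_{j-1}d^\varepsilon_i$ for $i<j$; $d^\varepsilon_is_j=s_jd^\varepsilon_{i-1}$ for $i>j+1$; and $d^\varepsilon_is_i=d^\varepsilon_{i+1}s_i$ for all $i$. It is semi-strong skew cubical if moreover $s_is_j=s_{j+1}s_i$ for all $i\leqslant j$, and $d^+_is_i=d^+_{i+1}s_i=\mathrm{Id}$ for all $i$ (this last condition is required for $\varepsilon=+$ only). *)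

theory Defs
  imports "HOL-Algebra.Module" "HOL-Algebra.AbelCoset"
begin

text \<open>
  Only the values of a map on the carrier of its source are meaningful, so equations between
  maps are stated pointwise on carriers throughout.
\<close>

definition mod_hom ::
  "('r, 'p) ring_scheme \<Rightarrow> ('r, 'a, 'm) module_scheme \<Rightarrow> ('r, 'b, 'n) module_scheme \<Rightarrow> ('a \<Rightarrow> 'b) set"
  where "mod_hom R M N =
    {f. f \<in> carrier M \<rightarrow> carrier N \<and>
        (\<forall>x\<in>carrier M. \<forall>y\<in>carrier M. f (x \<oplus>\<^bsub>M\<^esub> y) = f x \<oplus>\<^bsub>N\<^esub> f y) \<and>
        (\<forall>a\<in>carrier R. \<forall>x\<in>carrier M. f (a \<odot>\<^bsub>M\<^esub> x) = a \<odot>\<^bsub>N\<^esub> f x)}"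

text \<open>
  Families are indexed as follows: \<open>d \<epsilon> k i\<close> is the boundary $d^\epsilon_i : C_k \to C_{k-1}$
  and \<open>s k i\<close> is the degeneracy $s_i : C_k \to C_{k+1}$; they are meaningful only for
  $1 \le i \le k$.  All $C_k$ have carriers in one common type, but the carriers themselves and
  the module operations depend on $k$.
\<close>

datatype sign = Plus | Minus

locale pre_cubical_module =
  fixes R :: "('r, 'p) ring_scheme"
    and C :: "nat \<Rightarrow> ('r, 'a, 'm) module_scheme"
    and d :: "sign \<Rightarrow> nat \<Rightarrow> nat \<Rightarrow> 'a \<Rightarrow> 'a"
  assumes module_C: "\<And>k. module R (C k)"
    and d_hom: "\<And>\<epsilon> k i. 1 \<le> i \<Longrightarrow> i \<le> k \<Longrightarrow> d \<epsilon> k i \<in> mod_hom R (C k) (C (k - 1))"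
    and d_d: "\<And>\<epsilon> \<zeta> k i j x. 1 \<le> i \<Longrightarrow> i < j \<Longrightarrow> j \<le> k \<Longrightarrow> x \<in> carrier (C k) \<Longrightarrow>
      d \<epsilon> (k - 1) i (d \<zeta> k j x) = d \<zeta> (k - 1) (j - 1) (d \<epsilon> k i x)"

locale weak_skew_cubical_module = pre_cubical_module R C d
  for R :: "('r, 'p) ring_scheme"
    and C :: "nat \<Rightarrow> ('r, 'a, 'm) module_scheme"
    and d :: "sign \<Rightarrow> nat \<Rightarrow> nat \<Rightarrow> 'a \<Rightarrow> 'a" +
  fixes s :: "nat \<Rightarrow> nat \<Rightarrow> 'a \<Rightarrow> 'a"
  assumes s_hom: "\<And>k i. 1 \<le> i \<Longrightarrow> i \<le> k \<Longrightarrow> s k i \<in> mod_hom R (C k) (C (k + 1))"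
    and d_s_less: "\<And>\<epsilon> k i j x. 1 \<le> i \<Longrightarrow> i < j \<Longrightarrow> j \<le> k \<Longrightarrow> x \<in> carrier (C k) \<Longrightarrow>
      d \<epsilon> (k + 1) i (s k j x) = s (k - 1) (j - 1) (d \<epsilon> k i x)"
    and d_s_greater: "\<And>\<epsilon> k i j x. 1 \<le> j \<Longrightarrow> j + 1 < i \<Longrightarrow> i \<le> k + 1 \<Longrightarrow> x \<in> carrier (C k) \<Longrightarrow>
      d \<epsilon> (k + 1) i (s k j x) = s (k - 1) j (d \<epsilon> k (i - 1) x)"
    and d_s_same: "\<And>\<epsilon> k i x. 1 \<le> i \<Longrightarrow> i \<le> k \<Longrightarrow> x \<in> carrier (C k) \<Longrightarrow>
      d \<epsilon> (k + 1) i (s k i x) = d \<epsilon> (k + 1) (i + 1) (s k i x)"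

locale semi_strong_skew_cubical_module = weak_skew_cubical_module R C d s
  for R :: "('r, 'p) ring_scheme"
    and C :: "nat \<Rightarrow> ('r, 'a, 'm) module_scheme"
    and d :: "sign \<Rightarrow> nat \<Rightarrow> nat \<Rightarrow> 'a \<Rightarrow> 'a"
    and s :: "nat \<Rightarrow> nat \<Rightarrow> 'a \<Rightarrow> 'a" +
  assumes s_s: "\<And>k i j x. 1 \<le> i \<Longrightarrow> i \<le> j \<Longrightarrow> j \<le> k \<Longrightarrow> x \<in> carrier (C k) \<Longrightarrow>
      s (k + 1) i (s k j x) = s (k + 1) (j + 1) (s k i x)"
    and d_Plus_s: "\<And>k i x. 1 \<le> i \<Longrightarrow> i \<le> k \<Longrightarrow> x \<in> carrier (C k) \<Longrightarrow>
      d Plus (k + 1) i (s k i x) = x"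
    and d_Plus_Suc_s: "\<And>k i x. 1 \<le> i \<Longrightarrow> i \<le> k \<Longrightarrow> x \<in> carrier (C k) \<Longrightarrow>
      d Plus (k + 1) (i + 1) (s k i x) = x"

text \<open>
  Complexes are concentrated in degrees $k \ge 0$, with the differential out of degree $0$
  being the zero map to $C_{-1} = 0$; hence conditions on \<open>D k\<close> are imposed for $k \ge 1$ only.
\<close>

definition chain_complex ::
  "('r, 'p) ring_scheme \<Rightarrow> (nat \<Rightarrow> ('r, 'a, 'm) module_scheme) \<Rightarrow> (nat \<Rightarrow> 'a \<Rightarrow> 'a) \<Rightarrow> bool"
  where "chain_complex R C D \<longleftrightarrow>
    (\<forall>k. module R (C k)) \<and>
    (\<forall>k\<ge>1. D k \<in> mod_hom R (C k) (C (k - 1))) \<and>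
    (\<forall>k\<ge>2. \<forall>x\<in>carrier (C k). D (k - 1) (D k x) = \<zero>\<^bsub>C (k - 2)\<^esub>)"

definition subcomplex ::
  "('r, 'p) ring_scheme \<Rightarrow> (nat \<Rightarrow> ('r, 'a, 'm) module_scheme) \<Rightarrow> (nat \<Rightarrow> 'a \<Rightarrow> 'a) \<Rightarrow>
    (nat \<Rightarrow> 'a set) \<Rightarrow> bool"
  where "subcomplex R C D S \<longleftrightarrow>
    chain_complex R C D \<and>
    (\<forall>k. submodule (S k) R (C k)) \<and>
    (\<forall>k\<ge>1. D k ` S k \<subseteq> S (k - 1))"

definition direct_sum_decomposition ::
  "('r, 'p) ring_scheme \<Rightarrow> ('r, 'a, 'm) module_scheme \<Rightarrow> 'a set \<Rightarrow> 'a set \<Rightarrow> bool"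
  where "direct_sum_decomposition R M A B \<longleftrightarrow>
    submodule A R M \<and> submodule B R M \<and>
    A <+>\<^bsub>M\<^esub> B = carrier M \<and> A \<inter> B = {\<zero>\<^bsub>M\<^esub>}"

definition chain_complex_splitting ::
  "('r, 'p) ring_scheme \<Rightarrow> (nat \<Rightarrow> ('r, 'a, 'm) module_scheme) \<Rightarrow> (nat \<Rightarrow> 'a \<Rightarrow> 'a) \<Rightarrow>
    (nat \<Rightarrow> 'a set) \<Rightarrow> (nat \<Rightarrow> 'a set) \<Rightarrow> bool"
  where "chain_complex_splitting R C D A B \<longleftrightarrow>
    subcomplex R C D A \<and> subcomplex R C D B \<and>
    (\<forall>k. direct_sum_decomposition R (C k) (A k) (B k))"

definition alt_sum ::
  "('r, 'p) ring_scheme \<Rightarrow> (nat \<Rightarrow> ('r, 'a, 'm) module_scheme) \<Rightarrow>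
    (sign \<Rightarrow> nat \<Rightarrow> nat \<Rightarrow> 'a \<Rightarrow> 'a) \<Rightarrow> sign \<Rightarrow> nat \<Rightarrow> 'a \<Rightarrow> 'a"
  where "alt_sum R C d \<epsilon> k x =
    (\<Oplus>\<^bsub>C (k - 1)\<^esub> i \<in> {1..k}. ((\<ominus>\<^bsub>R\<^esub> \<one>\<^bsub>R\<^esub>) [^]\<^bsub>R\<^esub> (i - 1)) \<odot>\<^bsub>C (k - 1)\<^esub> d \<epsilon> k i x)"

definition total_boundary ::
  "('r, 'p) ring_scheme \<Rightarrow> (nat \<Rightarrow> ('r, 'a, 'm) module_scheme) \<Rightarrow>
    (sign \<Rightarrow> nat \<Rightarrow> nat \<Rightarrow> 'a \<Rightarrow> 'a) \<Rightarrow> 'r \<Rightarrow> 'r \<Rightarrow> nat \<Rightarrow> 'a \<Rightarrow> 'a"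
  where "total_boundary R C d \<alpha> \<beta> k x =
    (\<alpha> \<odot>\<^bsub>C (k - 1)\<^esub> alt_sum R C d Plus k x) \<oplus>\<^bsub>C (k - 1)\<^esub>
    (\<beta> \<odot>\<^bsub>C (k - 1)\<^esub> alt_sum R C d Minus k x)"

text \<open>For $k \le 1$ the sum below is empty, so the degenerate part is the zero submodule.\<close>

definition degenerate_part ::
  "(nat \<Rightarrow> ('r, 'a, 'm) module_scheme) \<Rightarrow> (nat \<Rightarrow> nat \<Rightarrow> 'a \<Rightarrow> 'a) \<Rightarrow> nat \<Rightarrow> 'a set"
  where "degenerate_part C s k =
    {(\<Oplus>\<^bsub>C k\<^esub> i \<in> {1..k - 1}. y i) | y.
       \<forall>i\<in>{1..k - 1}. y i \<in> s (k - 1) i ` carrier (C (k - 1))}"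

text \<open>The factor with index $k - 1$ is applied first; \<open>eta\<close> is the identity for $k \le 1$.\<close>

definition eta ::
  "(nat \<Rightarrow> ('r, 'a, 'm) module_scheme) \<Rightarrow> (sign \<Rightarrow> nat \<Rightarrow> nat \<Rightarrow> 'a \<Rightarrow> 'a) \<Rightarrow>
    (nat \<Rightarrow> nat \<Rightarrow> 'a \<Rightarrow> 'a) \<Rightarrow> nat \<Rightarrow> 'a \<Rightarrow> 'a"
  where "eta C d s k =
    foldr (\<lambda>i g. (\<lambda>x. x \<ominus>\<^bsub>C k\<^esub> s (k - 1) i (d Plus k (i + 1) x)) \<circ> g) [1..<k] id"

definition normalized_part ::
  "(nat \<Rightarrow> ('r, 'a, 'm) module_scheme) \<Rightarrow> (sign \<Rightarrow> nat \<Rightarrow> nat \<Rightarrow> 'a \<Rightarrow> 'a) \<Rightarrow>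
    (nat \<Rightarrow> nat \<Rightarrow> 'a \<Rightarrow> 'a) \<Rightarrow> nat \<Rightarrow> 'a set"
  where "normalized_part C d s k = eta C d s k ` carrier (C k)"

end

theory Submission
  imports Defs
begin

text \<open>
  The combined faces $\delta_i = \alpha d^+_i + \beta d^-_i$ satisfy the pre-cubical relations among
  themselves and with each $d^\varepsilon_j$, and the relations of the $d^\varepsilon_i$ with the
  degeneracies, so $\partial = \sum_i (-1)^{i-1} \delta_i$ behaves like the boundary of a single
  family of faces.  In $\partial s_j$ the terms $i = j$ and $i = j + 1$ cancel, and the others lie
  in the image of some degeneracy.

  For the splitting, put $p_i = \mathrm{Id} - s_i d^+_{i+1}$, so that $\eta_k = p_1 \cdots p_{k-1}$.
  Since $p_i s_j = s_j p_{i-1}$ for $j < i$ and $p_j s_j = 0$, the map $\eta_k$ kills the degenerate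
  part; since $d^+_{j+1} p_i = p_i d^+_{j+1}$ for $i < j$ and $d^+_{j+1} p_j = 0$, its image is
  the common kernel of $d^+_2, \dots, d^+_k$, on which it is the identity.  As
  $\mathrm{Id} - \eta_k$ takes degenerate values, the two parts are complementary, and the
  description as a common kernel shows that $\partial$ preserves the normalized part.
\<close>

section \<open>Module homomorphisms and submodules\<close>

lemma mod_homI:
  assumes "\<And>x. x \<in> carrier M \<Longrightarrow> f x \<in> carrier N"
    and "\<And>x y. x \<in> carrier M \<Longrightarrow> y \<in> carrier M \<Longrightarrow> f (x \<oplus>\<^bsub>M\<^esub> y) = f x \<oplus>\<^bsub>N\<^esub> f y"
    and "\<And>a x. a \<in> carrier R \<Longrightarrow> x \<in> carrier M \<Longrightarrow> f (a \<odot>\<^bsub>M\<^esub> x) = a \<odot>\<^bsub>N\<^esub> f x"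
  shows "f \<in> mod_hom R M N"
  using assms by (auto simp: mod_hom_def)

lemma mod_hom_closed: "f \<in> mod_hom R M N \<Longrightarrow> x \<in> carrier M \<Longrightarrow> f x \<in> carrier N"
  by (auto simp: mod_hom_def)

lemma mod_hom_add:
  "f \<in> mod_hom R M N \<Longrightarrow> x \<in> carrier M \<Longrightarrow> y \<in> carrier M \<Longrightarrow> f (x \<oplus>\<^bsub>M\<^esub> y) = f x \<oplus>\<^bsub>N\<^esub> f y"
  by (auto simp: mod_hom_def)

lemma mod_hom_smult:
  "f \<in> mod_hom R M N \<Longrightarrow> a \<in> carrier R \<Longrightarrow> x \<in> carrier M \<Longrightarrow> f (a \<odot>\<^bsub>M\<^esub> x) = a \<odot>\<^bsub>N\<^esub> f x"
  by (auto simp: mod_hom_def)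

lemma mod_hom_zero:
  assumes "module R M" "module R N" "f \<in> mod_hom R M N"
  shows "f \<zero>\<^bsub>M\<^esub> = \<zero>\<^bsub>N\<^esub>"
proof -
  interpret M: module R M by fact
  interpret N: module R N by fact
  have "f (\<zero>\<^bsub>R\<^esub> \<odot>\<^bsub>M\<^esub> \<zero>\<^bsub>M\<^esub>) = \<zero>\<^bsub>R\<^esub> \<odot>\<^bsub>N\<^esub> f \<zero>\<^bsub>M\<^esub>"
    by (rule mod_hom_smult[OF assms(3)]) auto
  then show ?thesis using mod_hom_closed[OF assms(3), of "\<zero>\<^bsub>M\<^esub>"] by simp
qed

lemma mod_hom_uminus:
  assumes "module R M" "module R N" "f \<in> mod_hom R M N" "x \<in> carrier M"
  shows "f (\<ominus>\<^bsub>M\<^esub> x) = \<ominus>\<^bsub>N\<^esub> f x"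
proof -
  interpret M: module R M by fact
  interpret N: module R N by fact
  have "f (\<ominus>\<^bsub>M\<^esub> x) = f ((\<ominus>\<^bsub>R\<^esub> \<one>\<^bsub>R\<^esub>) \<odot>\<^bsub>M\<^esub> x)"
    using assms(4) by (simp add: M.smult_l_minus)
  also have "\<dots> = (\<ominus>\<^bsub>R\<^esub> \<one>\<^bsub>R\<^esub>) \<odot>\<^bsub>N\<^esub> f x"
    using assms(4) by (simp add: mod_hom_smult[OF assms(3)])
  also have "\<dots> = \<ominus>\<^bsub>N\<^esub> f x"
    using mod_hom_closed[OF assms(3,4)] by (simp add: N.smult_l_minus)
  finally show ?thesis .
qed

lemma mod_hom_diff:
  assumes "module R M" "module R N" "f \<in> mod_hom R M N" "x \<in> carrier M" "y \<in> carrier M"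
  shows "f (x \<ominus>\<^bsub>M\<^esub> y) = f x \<ominus>\<^bsub>N\<^esub> f y"
proof -
  interpret M: module R M by fact
  show ?thesis
    using assms by (simp add: a_minus_def mod_hom_add[OF assms(3)] mod_hom_uminus[OF assms(1-3)])
qed

lemma mod_hom_id: "id \<in> mod_hom R M M"
  by (simp add: mod_hom_def)

lemma mod_hom_comp: "g \<in> mod_hom R N P \<Longrightarrow> f \<in> mod_hom R M N \<Longrightarrow> g \<circ> f \<in> mod_hom R M P"
  by (auto simp: mod_hom_def Pi_iff)

lemma mod_hom_const_zero: "module R N \<Longrightarrow> (\<lambda>x. \<zero>\<^bsub>N\<^esub>) \<in> mod_hom R M N"
proof -
  assume "module R N"
  then interpret N: module R N .
  show ?thesis by (auto intro: mod_homI)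
qed

lemma mod_hom_plus:
  assumes "module R N" "f \<in> mod_hom R M N" "g \<in> mod_hom R M N"
  shows "(\<lambda>x. f x \<oplus>\<^bsub>N\<^esub> g x) \<in> mod_hom R M N"
proof -
  interpret N: module R N by fact
  show ?thesis
    using assms(2,3)
    by (intro mod_homI)
      (simp_all add: mod_hom_closed mod_hom_add mod_hom_smult N.smult_r_distr N.a_ac)
qed

lemma mod_hom_scale:
  assumes "module R N" "a \<in> carrier R" "f \<in> mod_hom R M N"
  shows "(\<lambda>x. a \<odot>\<^bsub>N\<^esub> f x) \<in> mod_hom R M N"
proof -
  interpret N: module R N by fact
  show ?thesis
    using assms(2,3)
    by (intro mod_homI)
      (simp_all add: mod_hom_closed mod_hom_add mod_hom_smult N.smult_r_distr N.R.m_comm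
        flip: N.smult_assoc1)
qed

lemma mod_hom_minus:
  assumes "module R N" "f \<in> mod_hom R M N" "g \<in> mod_hom R M N"
  shows "(\<lambda>x. f x \<ominus>\<^bsub>N\<^esub> g x) \<in> mod_hom R M N"
proof -
  interpret N: module R N by fact
  show ?thesis
    using assms(2,3)
    by (intro mod_homI)
      (simp_all add: mod_hom_closed mod_hom_add mod_hom_smult a_minus_def N.smult_r_distr
        N.smult_r_minus N.minus_add N.a_ac)
qed

section \<open>Closure properties of submodules\<close>

lemma submodule_zero_closed:
  assumes "module R M" "submodule H R M"
  shows "\<zero>\<^bsub>M\<^esub> \<in> H"
  using subgroup.one_closed[OF submodule.axioms(1)[OF assms(2)]] by simp

lemma submodule_finsum_closed:
  assumes "module R M" "submodule H R M" "\<And>i. i \<in> A \<Longrightarrow> y i \<in> H"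
  shows "(\<Oplus>\<^bsub>M\<^esub> i \<in> A. y i) \<in> H"
proof -
  interpret M: module R M by fact
  note H = M.submoduleE[OF assms(2)]
  show ?thesis
    using assms(3)
  \<comment> \<open>An infinite \<open>A\<close> is covered as well: \<open>finsum\<close> then has
    its default value zero, which lies in \<open>H\<close>.\<close>
  proof (induction A rule: infinite_finite_induct)
    case (insert i A)
    then have "y \<in> A \<rightarrow> carrier M" "y i \<in> carrier M" using H(1) by auto
    then show ?case using insert by (simp add: M.finsum_insert H)
  qed (simp_all add: M.finsum_infinite submodule_zero_closed[OF assms(1,2)])
qed

lemma submodule_zero:
  assumes "module R M"
  shows "submodule {\<zero>\<^bsub>M\<^esub>} R M"
proof -
  interpret M: module R M by fact
  show ?thesis by (rule M.submoduleI) auto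
qed

lemma mod_hom_vimage_submodule:
  assumes "module R M" "module R N" "f \<in> mod_hom R M N" "submodule H R N"
  shows "submodule {x \<in> carrier M. f x \<in> H} R M"
proof -
  interpret M: module R M by fact
  interpret N: module R N by fact
  note H = N.submoduleE[OF assms(4)]
  show ?thesis
    using submodule_zero_closed[OF assms(2,4)]
    by (intro M.submoduleI)
      (auto simp: mod_hom_zero[OF assms(1-3)] mod_hom_uminus[OF assms(1-3)]
        mod_hom_add[OF assms(3)] mod_hom_smult[OF assms(3)] H)
qed

lemma mod_hom_image_submodule:
  assumes "module R M" "module R N" "f \<in> mod_hom R M N"
  shows "submodule (f ` carrier M) R N"
proof -
  interpret M: module R M by fact
  interpret N: module R N by fact
  show ?thesis
  proof (rule N.submoduleI)
    show "f ` carrier M \<subseteq> carrier N"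
      using mod_hom_closed[OF assms(3)] by auto
    show "\<zero>\<^bsub>N\<^esub> \<in> f ` carrier M"
      using mod_hom_zero[OF assms] M.zero_closed by (metis imageI)
  next
    fix a assume "a \<in> f ` carrier M"
    then show "\<ominus>\<^bsub>N\<^esub> a \<in> f ` carrier M"
      by (auto simp flip: mod_hom_uminus[OF assms])
  next
    fix a b assume "a \<in> f ` carrier M" "b \<in> f ` carrier M"
    then show "a \<oplus>\<^bsub>N\<^esub> b \<in> f ` carrier M"
      by (auto simp flip: mod_hom_add[OF assms(3)])
  next
    fix a x assume "a \<in> carrier R" "x \<in> f ` carrier M"
    then show "a \<odot>\<^bsub>N\<^esub> x \<in> f ` carrier M"
      by (auto simp flip: mod_hom_smult[OF assms(3)])
  qed
qed


section \<open>The boundary as an alternating sum of combined faces\<close>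

context pre_cubical_module
begin

sublocale C: module R "C k" for k
  by (rule module_C)

lemmas d_closed = mod_hom_closed[OF d_hom]

definition face :: "'r \<Rightarrow> 'r \<Rightarrow> nat \<Rightarrow> nat \<Rightarrow> 'a \<Rightarrow> 'a"
  where "face \<alpha> \<beta> k i x =
    (\<alpha> \<odot>\<^bsub>C (k - 1)\<^esub> d Plus k i x) \<oplus>\<^bsub>C (k - 1)\<^esub> (\<beta> \<odot>\<^bsub>C (k - 1)\<^esub> d Minus k i x)"

text \<open>The boundary truncated after \<open>m\<close> combined faces. Recursion on
  \<open>m\<close> lets \<open>face\<close> relations be lifted to sums by induction, with no
  reindexing of double sums; the exponent \<open>m\<close> at face \<open>Suc m\<close> is the sign
  (-1)^(i-1).\<close>

primrec partial_boundary :: "'r \<Rightarrow> 'r \<Rightarrow> nat \<Rightarrow> nat \<Rightarrow> 'a \<Rightarrow> 'a"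
  where
    "partial_boundary \<alpha> \<beta> k 0 x = \<zero>\<^bsub>C (k - 1)\<^esub>"
  | "partial_boundary \<alpha> \<beta> k (Suc m) x = partial_boundary \<alpha> \<beta> k m x \<oplus>\<^bsub>C (k - 1)\<^esub>
      (((\<ominus>\<^bsub>R\<^esub> \<one>\<^bsub>R\<^esub>) [^]\<^bsub>R\<^esub> m) \<odot>\<^bsub>C (k - 1)\<^esub> face \<alpha> \<beta> k (Suc m) x)"

context
  fixes \<alpha> \<beta>
  assumes scalars [simp]: "\<alpha> \<in> carrier R" "\<beta> \<in> carrier R"
begin

lemma face_hom:
  assumes "1 \<le> i" "i \<le> k"
  shows "face \<alpha> \<beta> k i \<in> mod_hom R (C k) (C (k - 1))"
  unfolding face_def
  by (intro mod_hom_plus mod_hom_scale module_C scalars d_hom assms)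

lemmas face_closed = mod_hom_closed[OF face_hom]

text \<open>Since \<open>d_d\<close> holds for every pair of signs, it survives a linear combination
  of the upper face over its sign. \<open>face_d\<close> combines the lower face instead.\<close>

lemma d_face:
  assumes "1 \<le> i" "i < j" "j \<le> k" "x \<in> carrier (C k)"
  shows "d \<epsilon> (k - 1) i (face \<alpha> \<beta> k j x) = face \<alpha> \<beta> (k - 1) (j - 1) (d \<epsilon> k i x)"
proof -
  have "d \<epsilon> (k - 1) i \<in> mod_hom R (C (k - 1)) (C (k - 1 - 1))"
    using assms by (intro d_hom) auto
  then show ?thesis
    using assms d_d[OF assms]
    by (simp add: face_def mod_hom_add mod_hom_smult d_closed[simplified])
qed

lemma face_d:
  assumes "1 \<le> i" "i < j" "j \<le> k" "x \<in> carrier (C k)"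
  shows "face \<alpha> \<beta> (k - 1) i (d \<epsilon> k j x) = d \<epsilon> (k - 1) (j - 1) (face \<alpha> \<beta> k i x)"
proof -
  have "d \<epsilon> (k - 1) (j - 1) \<in> mod_hom R (C (k - 1)) (C (k - 1 - 1))"
    using assms by (intro d_hom) auto
  then show ?thesis
    using assms d_d[OF assms]
    by (simp add: face_def mod_hom_add mod_hom_smult d_closed[simplified])
qed

text \<open>Expanding the outer lower face reduces this to \<open>d_face\<close> for each sign;
  linearity of the remaining \<open>face\<close> reassembles the combination.\<close>

lemma face_face:
  assumes "1 \<le> i" "i < j" "j \<le> k" "x \<in> carrier (C k)"
  shows "face \<alpha> \<beta> (k - 1) i (face \<alpha> \<beta> k j x) = face \<alpha> \<beta> (k - 1) (j - 1) (face \<alpha> \<beta> k i x)"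
proof -
  have f: "face \<alpha> \<beta> (k - 1) (j - 1) \<in> mod_hom R (C (k - 1)) (C (k - 1 - 1))"
    using assms by (intro face_hom) auto
  have "face \<alpha> \<beta> (k - 1) i (face \<alpha> \<beta> k j x) =
    (\<alpha> \<odot>\<^bsub>C (k - 1 - 1)\<^esub> face \<alpha> \<beta> (k - 1) (j - 1) (d Plus k i x)) \<oplus>\<^bsub>C (k - 1 - 1)\<^esub>
    (\<beta> \<odot>\<^bsub>C (k - 1 - 1)\<^esub> face \<alpha> \<beta> (k - 1) (j - 1) (d Minus k i x))"
    unfolding face_def[of _ _ "k - 1" i] by (simp only: d_face[OF assms])
  also have "\<dots> = face \<alpha> \<beta> (k - 1) (j - 1) (face \<alpha> \<beta> k i x)"
    unfolding face_def[of _ _ k i] using assms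
    by (simp only: mod_hom_add[OF f] mod_hom_smult[OF f] d_closed C.smult_closed scalars)
  finally show ?thesis .
qed

section \<open>Truncated boundaries and their composites\<close>

lemma partial_boundary_hom:
  "m \<le> k \<Longrightarrow> partial_boundary \<alpha> \<beta> k m \<in> mod_hom R (C k) (C (k - 1))"
proof (induction m)
  case 0
  then show ?case
    using mod_hom_const_zero[OF module_C] by (simp add: partial_boundary.simps(1)[abs_def])
next
  case (Suc m)
  then show ?case
    unfolding partial_boundary.simps(2)[abs_def]
    by (intro mod_hom_plus mod_hom_scale module_C face_hom) auto
qed

lemmas partial_boundary_closed = mod_hom_closed[OF partial_boundary_hom]

text \<open>Every face in the sum has index at most \<open>m\<close>, hence below \<open>i\<close>,
  so \<open>face_face\<close> applies to each term. The bound \<open>Suc m < i\<close> also keeps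
  \<open>i - 1\<close> at least 1 when \<open>m = 0\<close>.\<close>

lemma partial_boundary_face:
  assumes "Suc m < i" "i \<le> k" "x \<in> carrier (C k)"
  shows "partial_boundary \<alpha> \<beta> (k - 1) m (face \<alpha> \<beta> k i x) =
    face \<alpha> \<beta> (k - 1) (i - 1) (partial_boundary \<alpha> \<beta> k m x)"
proof -
  have f: "face \<alpha> \<beta> (k - 1) (i - 1) \<in> mod_hom R (C (k - 1)) (C (k - 1 - 1))"
    using assms by (intro face_hom) auto
  show ?thesis
    using assms(1)
  proof (induction m)
    case 0
    show ?case by (simp add: mod_hom_zero[OF module_C module_C f, simplified])
  next
    case (Suc m)
    then show ?case
      using assms face_face[of "Suc m" i k x]
      by (simp add: mod_hom_add[OF f, simplified] mod_hom_smult[OF f, simplified]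
          face_closed[simplified] partial_boundary_closed[simplified])
  qed
qed

text \<open>Staggering the truncations, \<open>m\<close> outside and \<open>Suc m\<close> inside,
  makes the composite vanish at every stage, so a single induction replaces the usual pairing of
  terms in a double sum. The square of the full boundary is the case
  \<open>m = Suc n\<close>.\<close>

lemma partial_boundary_partial_boundary:
  assumes "x \<in> carrier (C (Suc (Suc n)))" "m \<le> Suc n"
  shows "partial_boundary \<alpha> \<beta> (Suc n) m (partial_boundary \<alpha> \<beta> (Suc (Suc n)) (Suc m) x) = \<zero>\<^bsub>C n\<^esub>"
  using assms(2)
proof (induction m)
  case 0
  show ?case by simp
next
  case (Suc m)
  let ?e = "(\<ominus>\<^bsub>R\<^esub> \<one>\<^bsub>R\<^esub>) [^]\<^bsub>R\<^esub> m"
  let ?f = "face \<alpha> \<beta> (Suc n) (Suc m)"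
  let ?A = "partial_boundary \<alpha> \<beta> (Suc n) m"
  let ?B = "partial_boundary \<alpha> \<beta> (Suc (Suc n)) (Suc m) x"
  let ?w = "partial_boundary \<alpha> \<beta> (Suc (Suc n)) m x"
  let ?y = "face \<alpha> \<beta> (Suc (Suc n)) (Suc m) x"
  let ?u = "face \<alpha> \<beta> (Suc (Suc n)) (Suc (Suc m)) x"
  have f: "?f \<in> mod_hom R (C (Suc n)) (C n)"
    using face_hom[of "Suc m" "Suc n"] Suc.prems by simp
  have A: "?A \<in> mod_hom R (C (Suc n)) (C n)"
    using partial_boundary_hom[of m "Suc n"] Suc.prems by simp
  have e: "?e \<in> carrier R" by simp
  have e': "(\<ominus>\<^bsub>R\<^esub> \<one>\<^bsub>R\<^esub>) [^]\<^bsub>R\<^esub> Suc m = \<ominus>\<^bsub>R\<^esub> ?e"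
    by (simp add: C.R.r_minus)
  have w: "?w \<in> carrier (C (Suc n))" and B: "?B \<in> carrier (C (Suc n))"
    using partial_boundary_closed[of m "Suc (Suc n)" x]
      partial_boundary_closed[of "Suc m" "Suc (Suc n)" x] Suc.prems assms by auto
  have y: "?y \<in> carrier (C (Suc n))" and u: "?u \<in> carrier (C (Suc n))"
    using face_closed[of "Suc m" "Suc (Suc n)" x] face_closed[of "Suc (Suc m)" "Suc (Suc n)" x]
      Suc.prems assms by auto
  have fu: "?f ?u = ?f ?y"
    using face_face[of "Suc m" "Suc (Suc m)" "Suc (Suc n)" x] Suc.prems assms by simp
  have Au: "?A ?u = ?f ?w"
    using partial_boundary_face[of m "Suc (Suc m)" "Suc (Suc n)" x] Suc.prems assms by simp
  have fB: "?f ?B = ?f ?w \<oplus>\<^bsub>C n\<^esub> ?e \<odot>\<^bsub>C n\<^esub> ?f ?y"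
    using w y by (simp add: mod_hom_add[OF f] mod_hom_smult[OF f])
  have c: "?f ?w \<in> carrier (C n)" "?f ?y \<in> carrier (C n)" "?f ?B \<in> carrier (C n)"
    using w y B by (auto intro: mod_hom_closed[OF f])
  have "partial_boundary \<alpha> \<beta> (Suc n) (Suc m) (partial_boundary \<alpha> \<beta> (Suc (Suc n)) (Suc (Suc m)) x) =
    ?A (?B \<oplus>\<^bsub>C (Suc n)\<^esub> (\<ominus>\<^bsub>R\<^esub> ?e) \<odot>\<^bsub>C (Suc n)\<^esub> ?u) \<oplus>\<^bsub>C n\<^esub>
    ?e \<odot>\<^bsub>C n\<^esub> ?f (?B \<oplus>\<^bsub>C (Suc n)\<^esub> (\<ominus>\<^bsub>R\<^esub> ?e) \<odot>\<^bsub>C (Suc n)\<^esub> ?u)"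
    unfolding partial_boundary.simps(2)[of _ _ "Suc n"]
      partial_boundary.simps(2)[of _ _ "Suc (Suc n)" "Suc m"] e' by simp
  \<comment> \<open>The induction hypothesis removes \<open>?A ?B\<close>. By \<open>Au\<close> and
    \<open>fu\<close> only \<open>?f ?w\<close> and \<open>?f ?y\<close> remain, and once
    \<open>?f ?B\<close> is expanded by \<open>fB\<close> each occurs with opposite
    coefficients.\<close>
  also have "\<dots> = (\<ominus>\<^bsub>R\<^esub> ?e) \<odot>\<^bsub>C n\<^esub> ?f ?w \<oplus>\<^bsub>C n\<^esub>
    ?e \<odot>\<^bsub>C n\<^esub> (?f ?B \<oplus>\<^bsub>C n\<^esub> (\<ominus>\<^bsub>R\<^esub> ?e) \<odot>\<^bsub>C n\<^esub> ?f ?y)"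
    using B u e Suc c
    by (simp del: partial_boundary.simps
        add: mod_hom_add[OF f] mod_hom_smult[OF f] mod_hom_add[OF A] mod_hom_smult[OF A] fu Au)
  also have "\<dots> = \<zero>\<^bsub>C n\<^esub>"
    unfolding fB using c e
    by (simp add: C.smult_l_minus C.M.a_assoc C.M.r_neg C.M.l_neg)
  finally show ?case .
qed

lemma total_boundary_eq:
  assumes "1 \<le> k" "x \<in> carrier (C k)"
  shows "total_boundary R C d \<alpha> \<beta> k x = partial_boundary \<alpha> \<beta> k k x"
proof -
  let ?M = "C (k - 1)"
  let ?g = "\<lambda>\<epsilon> i. ((\<ominus>\<^bsub>R\<^esub> \<one>\<^bsub>R\<^esub>) [^]\<^bsub>R\<^esub> (i - 1)) \<odot>\<^bsub>?M\<^esub> d \<epsilon> k i x"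
  \<comment> \<open>Truncating both alternating sums at the same \<open>m\<close> matches the
    recursion of \<open>partial_boundary\<close>.\<close>
  have "(\<alpha> \<odot>\<^bsub>?M\<^esub> (\<Oplus>\<^bsub>?M\<^esub> i \<in> {1..m}. ?g Plus i)) \<oplus>\<^bsub>?M\<^esub>
    (\<beta> \<odot>\<^bsub>?M\<^esub> (\<Oplus>\<^bsub>?M\<^esub> i \<in> {1..m}. ?g Minus i)) = partial_boundary \<alpha> \<beta> k m x" if "m \<le> k" for m
    using that
  proof (induction m)
    case 0
    show ?case by simp
  next
    case (Suc m)
    let ?e = "(\<ominus>\<^bsub>R\<^esub> \<one>\<^bsub>R\<^esub>) [^]\<^bsub>R\<^esub> m"
    let ?S = "\<lambda>\<epsilon>. \<Oplus>\<^bsub>?M\<^esub> i \<in> {1..m}. ?g \<epsilon> i"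
    have g: "?g \<epsilon> i \<in> carrier ?M" if "1 \<le> i" "i \<le> Suc m" for \<epsilon> i
      using that Suc.prems assms by (intro C.smult_closed d_closed) auto
    have S: "?S \<epsilon> \<in> carrier ?M" for \<epsilon>
      using g by (intro C.M.finsum_closed) auto
    have step: "(\<Oplus>\<^bsub>?M\<^esub> i \<in> {1..Suc m}. ?g \<epsilon> i) = ?g \<epsilon> (Suc m) \<oplus>\<^bsub>?M\<^esub> ?S \<epsilon>" for \<epsilon>
    proof -
      have "{1..Suc m} = insert (Suc m) {1..m}" by auto
      moreover have "?g \<epsilon> \<in> {1..m} \<rightarrow> carrier ?M"
        using g by (intro Pi_I) (auto simp del: One_nat_def)
      moreover have "?g \<epsilon> (Suc m) \<in> carrier ?M"
        by (intro g) auto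
      ultimately show ?thesis by (simp only: C.M.finsum_insert finite_atLeastAtMost) simp
    qed
    have dc: "d \<epsilon> k (Suc m) x \<in> carrier ?M" for \<epsilon>
      using Suc.prems assms by (intro d_closed) auto
    \<comment> \<open>Commutativity of the ring moves the sign outside the scalars, where it can be
      factored out of the combined face.\<close>
    have comm: "a \<odot>\<^bsub>?M\<^esub> (?e \<odot>\<^bsub>?M\<^esub> y) = ?e \<odot>\<^bsub>?M\<^esub> (a \<odot>\<^bsub>?M\<^esub> y)"
      if "a \<in> carrier R" "y \<in> carrier ?M" for a y
      using that by (simp add: C.R.m_comm flip: C.smult_assoc1)
    have "partial_boundary \<alpha> \<beta> k (Suc m) x =
      ((\<alpha> \<odot>\<^bsub>?M\<^esub> ?S Plus) \<oplus>\<^bsub>?M\<^esub> (\<beta> \<odot>\<^bsub>?M\<^esub> ?S Minus)) \<oplus>\<^bsub>?M\<^esub> (?e \<odot>\<^bsub>?M\<^esub> face \<alpha> \<beta> k (Suc m) x)"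
      using Suc by simp
    then show ?case
      unfolding step using S dc
      by (simp add: face_def C.smult_r_distr comm[simplified] C.M.a_ac)
  qed
  from this[of k] show ?thesis
    by (simp add: total_boundary_def alt_sum_def)
qed

lemma chain_complex_total_boundary: "chain_complex R C (total_boundary R C d \<alpha> \<beta>)"
  unfolding chain_complex_def
proof (intro conjI allI impI ballI)
  show "module R (C k)" for k by (rule module_C)
next
  fix k :: nat assume k: "1 \<le> k"
  have b: "partial_boundary \<alpha> \<beta> k k \<in> mod_hom R (C k) (C (k - 1))"
    by (rule partial_boundary_hom) simp
  show "total_boundary R C d \<alpha> \<beta> k \<in> mod_hom R (C k) (C (k - 1))"
    \<comment> \<open>The two descriptions of the boundary are known to agree on the carrier, so the
      homomorphism laws are transferred pointwise.\<close>
    using mod_hom_closed[OF b] mod_hom_add[OF b] mod_hom_smult[OF b]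
    by (intro mod_homI) (simp_all add: total_boundary_eq[OF k])
next
  fix k x assume "2 \<le> k" and x: "x \<in> carrier (C k)"
  then obtain n where n: "k = Suc (Suc n)"
    by (metis Suc_le_D numeral_2_eq_2 Suc_le_mono)
  have "partial_boundary \<alpha> \<beta> (Suc (Suc n)) (Suc (Suc n)) x \<in> carrier (C (Suc n))"
    using partial_boundary_closed[of k k x] x n by simp
  then show "total_boundary R C d \<alpha> \<beta> (k - 1) (total_boundary R C d \<alpha> \<beta> k x) = \<zero>\<^bsub>C (k - 2)\<^esub>"
    using x partial_boundary_partial_boundary[of x n "Suc n"] unfolding n
    by (simp add: total_boundary_eq del: partial_boundary.simps)
qed

text \<open>This is what makes the boundary preserve the common kernel of
  \<open>d^+_2, ..., d^+_k\<close>. Moving \<open>d^+_j\<close> inwards past a face of index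
  \<open>i\<close> gives \<open>d^+_j x\<close> if \<open>j < i\<close> and
  \<open>d^+_(j+1) x\<close> otherwise; as \<open>2 \<le> j \<le> k - 1\<close>, both
  vanish.\<close>

lemma partial_boundary_annihilated:
  assumes "\<And>j. 2 \<le> j \<Longrightarrow> j \<le> k \<Longrightarrow> d Plus k j x = \<zero>\<^bsub>C (k - 1)\<^esub>"
    and "2 \<le> j" "j \<le> k - 1" "x \<in> carrier (C k)" "m \<le> k"
  shows "d Plus (k - 1) j (partial_boundary \<alpha> \<beta> k m x) = \<zero>\<^bsub>C (k - 2)\<^esub>"
proof -
  have d: "d Plus (k - 1) j \<in> mod_hom R (C (k - 1)) (C (k - 2))"
    using d_hom[of j "k - 1" Plus] assms by (simp add: numeral_2_eq_2)
  have *: "d Plus (k - 1) j (face \<alpha> \<beta> k i x) = \<zero>\<^bsub>C (k - 2)\<^esub>" if "1 \<le> i" "i \<le> k" for i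
  proof (cases "j < i")
    case True
    have "face \<alpha> \<beta> (k - 1) (i - 1) \<in> mod_hom R (C (k - 1)) (C (k - 2))"
      using face_hom[of "i - 1" "k - 1"] that True assms(2) by (simp add: numeral_2_eq_2)
    then show ?thesis
      using d_face[of j i k x Plus] True that assms
      by (simp add: mod_hom_zero[OF module_C module_C])
  next
    case False
    have "face \<alpha> \<beta> (k - 1) i \<in> mod_hom R (C (k - 1)) (C (k - 2))"
      using face_hom[of i "k - 1"] that False assms by (simp add: numeral_2_eq_2)
    then show ?thesis
      using face_d[of i "j + 1" k x Plus] False that assms
      by (simp add: mod_hom_zero[OF module_C module_C])
  qed
  show ?thesis
    using assms(5)
  proof (induction m)
    case 0
    show ?case using mod_hom_zero[OF module_C module_C d] by simp
  next
    case (Suc m)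
    then show ?case
      using assms *[of "Suc m"]
      by (simp add: mod_hom_add[OF d, simplified] mod_hom_smult[OF d, simplified]
          face_closed[simplified] partial_boundary_closed[simplified])
  qed
qed

end

end


section \<open>The degenerate part\<close>

context weak_skew_cubical_module
begin

lemmas s_closed = mod_hom_closed[OF s_hom]

lemma s_hom_pred:
  assumes "1 \<le> i" "i \<le> k - 1"
  shows "s (k - 1) i \<in> mod_hom R (C (k - 1)) (C k)"
  using s_hom[OF assms] assms by simp

lemma s_in_degenerate_part:
  assumes "1 \<le> i" "i \<le> k - 1" "x \<in> carrier (C (k - 1))"
  shows "s (k - 1) i x \<in> degenerate_part C s k"
proof -
  \<comment> \<open>The other positions are filled with zero, which is a value of every
    degeneracy.\<close>
  let ?y = "\<lambda>j. if i = j then s (k - 1) i x else \<zero>\<^bsub>C k\<^esub>"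
  have "s (k - 1) i x \<in> carrier (C k)"
    using mod_hom_closed[OF s_hom_pred] assms by blast
  then have "(\<Oplus>\<^bsub>C k\<^esub> j \<in> {1..k - 1}. ?y j) = s (k - 1) i x"
    using C.M.finsum_singleton[of i "{1..k - 1}" "\<lambda>j. s (k - 1) i x" k] assms by simp
  moreover have "\<zero>\<^bsub>C k\<^esub> \<in> s (k - 1) j ` carrier (C (k - 1))" if "1 \<le> j" "j \<le> k - 1" for j
    using mod_hom_zero[OF module_C module_C s_hom_pred[OF that]] by (metis C.M.zero_closed imageI)
  ultimately show ?thesis
    unfolding degenerate_part_def using assms
    by (intro CollectI exI[of _ ?y]) auto
qed

text \<open>Reduces inclusions to generators. It is applied with \<open>H\<close> the whole module,
  a preimage under the boundary, and the kernel of \<open>eta\<close>.\<close>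

lemma degenerate_part_least:
  assumes "submodule H R (C k)"
    and "\<And>i x. 1 \<le> i \<Longrightarrow> i \<le> k - 1 \<Longrightarrow> x \<in> carrier (C (k - 1)) \<Longrightarrow> s (k - 1) i x \<in> H"
  shows "degenerate_part C s k \<subseteq> H"
  unfolding degenerate_part_def
  using assms(2) by (fastforce intro: submodule_finsum_closed[OF module_C assms(1)])

text \<open>The image of each degeneracy is a submodule, so the operations can be carried out
  summand by summand; negatives come from scaling by -1.\<close>

lemma submodule_degenerate_part: "submodule (degenerate_part C s k) R (C k)"
proof (rule C.submoduleI)
  let ?I = "\<lambda>i. s (k - 1) i ` carrier (C (k - 1))"
  have I: "submodule (?I i) R (C k)" if "i \<in> {1..k - 1}" for i
    using that by (intro mod_hom_image_submodule module_C s_hom_pred) auto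
  note I' = C.submoduleE[OF I]
  show sub: "degenerate_part C s k \<subseteq> carrier (C k)"
    by (rule degenerate_part_least[OF C.carrier_is_submodule])
      (rule mod_hom_closed[OF s_hom_pred])
  have "\<zero>\<^bsub>C k\<^esub> \<in> ?I i" if "i \<in> {1..k - 1}" for i
    using submodule_zero_closed[OF module_C I[OF that]] .
  then show "\<zero>\<^bsub>C k\<^esub> \<in> degenerate_part C s k"
    unfolding degenerate_part_def by (intro CollectI exI[of _ "\<lambda>i. \<zero>\<^bsub>C k\<^esub>"]) auto
  fix x assume x: "x \<in> degenerate_part C s k"
  then obtain y where y: "x = (\<Oplus>\<^bsub>C k\<^esub> i \<in> {1..k - 1}. y i)" "\<And>i. i \<in> {1..k - 1} \<Longrightarrow> y i \<in> ?I i"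
    unfolding degenerate_part_def by auto
  have yc: "y \<in> {1..k - 1} \<rightarrow> carrier (C k)"
    using y(2) I'(1) by blast
  show scale: "a \<odot>\<^bsub>C k\<^esub> x \<in> degenerate_part C s k" if "a \<in> carrier R" for a
  proof -
    have "a \<odot>\<^bsub>C k\<^esub> x = (\<Oplus>\<^bsub>C k\<^esub> i \<in> {1..k - 1}. a \<odot>\<^bsub>C k\<^esub> y i)"
      unfolding y(1) using that yc by (intro C.finsum_smult_ldistr) auto
    then show ?thesis
      unfolding degenerate_part_def using y(2) I'(4) that by blast
  qed
  show "\<ominus>\<^bsub>C k\<^esub> x \<in> degenerate_part C s k"
    using scale[of "\<ominus>\<^bsub>R\<^esub> \<one>\<^bsub>R\<^esub>"] x sub by (simp add: C.smult_l_minus subset_iff)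
  fix x' assume "x' \<in> degenerate_part C s k"
  then obtain y' where y': "x' = (\<Oplus>\<^bsub>C k\<^esub> i \<in> {1..k - 1}. y' i)" "\<And>i. i \<in> {1..k - 1} \<Longrightarrow> y' i \<in> ?I i"
    unfolding degenerate_part_def by auto
  have y'c: "y' \<in> {1..k - 1} \<rightarrow> carrier (C k)"
    using y'(2) I'(1) by blast
  have "x \<oplus>\<^bsub>C k\<^esub> x' = (\<Oplus>\<^bsub>C k\<^esub> i \<in> {1..k - 1}. y i \<oplus>\<^bsub>C k\<^esub> y' i)"
    unfolding y(1) y'(1) using yc y'c by (simp add: C.M.finsum_addf)
  then show "x \<oplus>\<^bsub>C k\<^esub> x' \<in> degenerate_part C s k"
    unfolding degenerate_part_def using y(2) y'(2) I'(5) by blast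
qed

context
  fixes \<alpha> \<beta>
  assumes scalars [simp]: "\<alpha> \<in> carrier R" "\<beta> \<in> carrier R"
begin

text \<open>The relation has the same form for both signs, and the degeneracy on the right is
  linear, so the combination passes through it.\<close>

lemma face_s_less:
  assumes "1 \<le> i" "i < j" "j \<le> k" "x \<in> carrier (C k)"
  shows "face \<alpha> \<beta> (k + 1) i (s k j x) = s (k - 1) (j - 1) (face \<alpha> \<beta> k i x)"
proof -
  have "s (k - 1) (j - 1) \<in> mod_hom R (C (k - 1)) (C k)"
    using assms by (intro s_hom_pred) auto
  then show ?thesis
    using assms by (simp add: face_def d_s_less[simplified] mod_hom_add mod_hom_smult d_closed[simplified])
qed

lemma face_s_greater:
  assumes "1 \<le> j" "j + 1 < i" "i \<le> k + 1" "x \<in> carrier (C k)"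
  shows "face \<alpha> \<beta> (k + 1) i (s k j x) = s (k - 1) j (face \<alpha> \<beta> k (i - 1) x)"
proof -
  have "s (k - 1) j \<in> mod_hom R (C (k - 1)) (C k)"
    using assms by (intro s_hom_pred) auto
  then show ?thesis
    using assms by (simp add: face_def d_s_greater[simplified] mod_hom_add mod_hom_smult d_closed[simplified])
qed

text \<open>Terms below \<open>j\<close> are values of \<open>s_(j-1)\<close>, terms above
  \<open>j + 1\<close> are values of \<open>s_j\<close>, and terms \<open>j\<close> and
  \<open>j + 1\<close> cancel. The truncation \<open>m = j\<close> is excluded because it would
  separate the cancelling pair.\<close>

lemma partial_boundary_s:
  assumes "1 \<le> j" "j \<le> n" "x \<in> carrier (C n)" "m \<le> n + 1" "m \<noteq> j"
  shows "partial_boundary \<alpha> \<beta> (n + 1) m (s n j x) \<in> degenerate_part C s n"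
proof -
  let ?D = "degenerate_part C s n"
  let ?p = "\<lambda>m. partial_boundary \<alpha> \<beta> (n + 1) m (s n j x)"
  let ?t = "\<lambda>i. face \<alpha> \<beta> (n + 1) i (s n j x)"
  let ?e = "\<lambda>m::nat. (\<ominus>\<^bsub>R\<^esub> \<one>\<^bsub>R\<^esub>) [^]\<^bsub>R\<^esub> m"
  note D = C.submoduleE[OF submodule_degenerate_part[of n]]
  have below: "?p m \<in> ?D" if "m < j" for m
    using that
  proof (induction m)
    case 0
    show ?case using submodule_zero_closed[OF module_C submodule_degenerate_part] by simp
  next
    case (Suc m)
    have "s (n - 1) (j - 1) (face \<alpha> \<beta> n (Suc m) x) \<in> ?D"
      using Suc.prems assms by (intro s_in_degenerate_part face_closed scalars) auto
    then have "?t (Suc m) \<in> ?D"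
      using face_s_less[of "Suc m" j n x] Suc.prems assms by simp
    then show ?case using Suc by (simp add: D)
  qed
  show ?thesis
  proof (cases "m < j")
    case False
    \<comment> \<open>The second induction starts at \<open>Suc j\<close>, jumping over the excluded
      value; its base case adds the cancelling pair to the sum ending at
      \<open>j - 1\<close>.\<close>
    then have "Suc j \<le> m" using assms by simp
    then show ?thesis
      using assms(4)
    proof (induction m rule: dec_induct)
      case base
      have s: "s n j x \<in> carrier (C (n + 1))"
        using assms by (intro s_closed) auto
      have t: "?t j \<in> carrier (C n)"
        using face_closed[of \<alpha> \<beta> j "n + 1", OF _ _ _ _ s] assms by simp
      have same: "?t (Suc j) = ?t j"
        using d_s_same[of j n x] assms by (simp add: face_def)
      obtain i where i: "j = Suc i" using assms by (cases j) auto
      have p: "?p i \<in> ?D" using below i by simp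
      have "?p (Suc j) = ?p i \<oplus>\<^bsub>C n\<^esub> ?e i \<odot>\<^bsub>C n\<^esub> ?t j \<oplus>\<^bsub>C n\<^esub> (\<ominus>\<^bsub>R\<^esub> ?e i) \<odot>\<^bsub>C n\<^esub> ?t j"
        using same i by (simp add: C.R.r_minus)
      also have "\<dots> = ?p i"
        using t p D(1) by (simp add: C.smult_l_minus C.M.a_assoc C.M.r_neg subset_iff)
      finally show ?case using p by simp
    next
      case (step m)
      have "s (n - 1) j (face \<alpha> \<beta> n m x) \<in> ?D"
        using step assms by (intro s_in_degenerate_part face_closed scalars) auto
      then have "?t (Suc m) \<in> ?D"
        using face_s_greater[of j "Suc m" n x] step assms by simp
      then show ?case using step by (simp add: D)
    qed
  qed (rule below)
qed

lemma subcomplex_degenerate_part: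
  "subcomplex R C (total_boundary R C d \<alpha> \<beta>) (degenerate_part C s)"
  unfolding subcomplex_def
proof (intro conjI allI impI)
  show "chain_complex R C (total_boundary R C d \<alpha> \<beta>)"
    by (rule chain_complex_total_boundary) simp_all
  show "submodule (degenerate_part C s k) R (C k)" for k
    by (rule submodule_degenerate_part)
  fix k :: nat assume "1 \<le> k"
  then obtain n where n: "k = n + 1" by (metis Suc_eq_plus1 Suc_le_D One_nat_def)
  have b: "partial_boundary \<alpha> \<beta> k k \<in> mod_hom R (C k) (C n)"
    using partial_boundary_hom[of \<alpha> \<beta> k k] n by simp
  \<comment> \<open>The elements whose boundary is degenerate form a submodule, so only generators
    need checking. The full sum has \<open>n + 1\<close> terms while the degeneracy index is at most
    \<open>n\<close>, so the excluded truncation does not occur.\<close>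
  have "degenerate_part C s k \<subseteq> {x \<in> carrier (C k). partial_boundary \<alpha> \<beta> k k x \<in> degenerate_part C s n}"
  proof (rule degenerate_part_least)
    show "submodule {x \<in> carrier (C k). partial_boundary \<alpha> \<beta> k k x \<in> degenerate_part C s n} R (C k)"
      by (intro mod_hom_vimage_submodule[OF module_C module_C b] submodule_degenerate_part)
  next
    fix i x assume "1 \<le> i" "i \<le> k - 1" "x \<in> carrier (C (k - 1))"
    then show "s (k - 1) i x \<in> {x \<in> carrier (C k). partial_boundary \<alpha> \<beta> k k x \<in> degenerate_part C s n}"
      using partial_boundary_s[of i n x "n + 1"] s_closed[of i n x]
      by (auto simp: n simp del: partial_boundary.simps)
  qed
  then show "total_boundary R C d \<alpha> \<beta> k ` degenerate_part C s k \<subseteq> degenerate_part C s (k - 1)"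
    by (auto simp: n total_boundary_eq simp del: partial_boundary.simps)
qed

end

end


section \<open>The normalized part\<close>

context semi_strong_skew_cubical_module
begin

definition proj :: "nat \<Rightarrow> nat \<Rightarrow> 'a \<Rightarrow> 'a"
  where "proj k i x = x \<ominus>\<^bsub>C k\<^esub> s (k - 1) i (d Plus k (i + 1) x)"

text \<open>The tail \<open>p_a ... p_(k-1)\<close> of the product, with \<open>p_a\<close>
  outermost. Inductions run downwards in \<open>a\<close>, adding factors on the left, and reach
  \<open>eta\<close> at \<open>a = 1\<close>.\<close>

definition eta_from :: "nat \<Rightarrow> nat \<Rightarrow> 'a \<Rightarrow> 'a"
  where "eta_from k a = foldr (\<lambda>i g. proj k i \<circ> g) [a..<k] id"

lemma eta_from_simps:
  "a < k \<Longrightarrow> eta_from k a x = proj k a (eta_from k (Suc a) x)"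
  "k \<le> a \<Longrightarrow> eta_from k a x = x"
  by (simp_all add: eta_from_def upt_conv_Cons)

lemma eta_eq: "eta C d s k = eta_from k 1"
  by (simp add: eta_def eta_from_def proj_def[abs_def])

lemma d_Suc_hom:
  "1 \<le> i \<Longrightarrow> i < k \<Longrightarrow> d \<epsilon> k (Suc i) \<in> mod_hom R (C k) (C (k - 1))"
  by (intro d_hom) auto

lemma proj_hom:
  assumes "1 \<le> i" "i < k"
  shows "proj k i \<in> mod_hom R (C k) (C k)"
proof -
  have "s (k - 1) i \<circ> d Plus k (Suc i) \<in> mod_hom R (C k) (C k)"
    using assms by (intro mod_hom_comp[OF s_hom_pred d_Suc_hom]) auto
  then have "(\<lambda>x. id x \<ominus>\<^bsub>C k\<^esub> (s (k - 1) i \<circ> d Plus k (Suc i)) x) \<in> mod_hom R (C k) (C k)"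
    by (intro mod_hom_minus module_C mod_hom_id)
  then show ?thesis by (simp add: proj_def[abs_def])
qed

lemma eta_from_hom: "1 \<le> a \<Longrightarrow> eta_from k a \<in> mod_hom R (C k) (C k)"
proof (induction "k - a" arbitrary: a)
  case 0
  then have "eta_from k a = id" by (simp add: eta_from_simps fun_eq_iff)
  then show ?case by (simp only: mod_hom_id)
next
  case (Suc n)
  then have "eta_from k a = proj k a \<circ> eta_from k (Suc a)"
    by (simp add: eta_from_simps fun_eq_iff)
  then show ?case using Suc by (auto intro!: mod_hom_comp proj_hom)
qed

lemmas eta_from_closed = mod_hom_closed[OF eta_from_hom]

section \<open>Relations of the factors of \<open>eta\<close> with degeneracies and faces\<close>

lemma proj_s_same:
  assumes "1 \<le> j" "j < k" "z \<in> carrier (C (k - 1))"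
  shows "proj k j (s (k - 1) j z) = \<zero>\<^bsub>C k\<^esub>"
proof -
  have "s (k - 1) j z \<in> carrier (C k)"
    using assms by (intro mod_hom_closed[OF s_hom_pred]) auto
  then show ?thesis
    using assms d_Plus_Suc_s[of j "k - 1" z]
    by (simp add: proj_def a_minus_def C.M.r_neg)
qed

text \<open>Here \<open>d^+_(i+1) s_j = s_j d^+_i\<close>, and then
  \<open>s_i s_j = s_j s_(i-1)\<close> brings \<open>s_j\<close> to the front; what is left is the
  factor \<open>p_(i-1)\<close> one degree lower.\<close>

lemma proj_s_less:
  assumes "1 \<le> j" "j < i" "i < k" "z \<in> carrier (C (k - 1))"
  shows "proj k i (s (k - 1) j z) = s (k - 1) j (proj (k - 1) (i - 1) z)"
proof -
  obtain n where n: "k = Suc (Suc n)"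
    using assms by (metis less_imp_Suc_add add_Suc_shift not_one_le_zero Suc_le_D le_less_trans add_Suc)
  have sj: "s (Suc n) j \<in> mod_hom R (C (Suc n)) (C k)"
    using s_hom[of j "Suc n"] assms n by simp
  have z: "z \<in> carrier (C (Suc n))" using assms n by simp
  have dz: "d Plus (Suc n) i z \<in> carrier (C n)"
    using d_closed[of i "Suc n" z Plus] z assms n by simp
  have sdz: "s n (i - 1) (d Plus (Suc n) i z) \<in> carrier (C (Suc n))"
    using s_closed[of "i - 1" n, OF _ _ dz] assms n by simp
  have "d Plus k (Suc i) (s (Suc n) j z) = s n j (d Plus (Suc n) i z)"
    using d_s_greater[of j "Suc i" "Suc n" z Plus] assms z n by simp
  moreover have "s (Suc n) j (s n (i - 1) (d Plus (Suc n) i z)) = s (Suc n) i (s n j (d Plus (Suc n) i z))"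
    using s_s[of j "i - 1" n "d Plus (Suc n) i z"] assms n dz by simp
  ultimately show ?thesis
    using mod_hom_diff[OF module_C module_C sj z sdz] assms by (simp add: proj_def n)
qed

lemma d_proj_same:
  assumes "1 \<le> j" "j < k" "x \<in> carrier (C k)"
  shows "d Plus k (Suc j) (proj k j x) = \<zero>\<^bsub>C (k - 1)\<^esub>"
proof -
  have dx: "d Plus k (Suc j) x \<in> carrier (C (k - 1))"
    using assms by (intro d_closed) auto
  then have "s (k - 1) j (d Plus k (Suc j) x) \<in> carrier (C k)"
    using assms by (intro mod_hom_closed[OF s_hom_pred]) auto
  then show ?thesis
    using mod_hom_diff[OF module_C module_C d_Suc_hom[OF assms(1,2)] assms(3)]
      d_Plus_Suc_s[of j "k - 1" "d Plus k (Suc j) x"] assms dx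
    by (simp add: proj_def a_minus_def C.M.r_neg)
qed

text \<open>Two moves carry \<open>d^+_(j+1)\<close> past \<open>s_i d^+_(i+1)\<close>: the
  degeneracy lowers its index to \<open>j\<close>, and the pre-cubical relation restores it to
  \<open>j + 1\<close>.\<close>

lemma d_proj_less:
  assumes "1 \<le> i" "i < j" "j < k" "x \<in> carrier (C k)"
  shows "d Plus k (Suc j) (proj k i x) = proj (k - 1) i (d Plus k (Suc j) x)"
proof -
  have dx: "d Plus k (Suc i) x \<in> carrier (C (k - 1))"
    using assms by (intro d_closed) auto
  then have sdx: "s (k - 1) i (d Plus k (Suc i) x) \<in> carrier (C k)"
    using assms by (intro mod_hom_closed[OF s_hom_pred]) auto
  have hj: "d Plus k (Suc j) \<in> mod_hom R (C k) (C (k - 1))"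
    using assms by (intro d_Suc_hom) auto
  have "d Plus k (Suc j) (s (k - 1) i (d Plus k (Suc i) x)) =
    s (k - 1 - 1) i (d Plus (k - 1) j (d Plus k (Suc i) x))"
    using d_s_greater[of i "Suc j" "k - 1" "d Plus k (Suc i) x" Plus] assms dx by simp
  also have "d Plus (k - 1) j (d Plus k (Suc i) x) = d Plus (k - 1) (Suc i) (d Plus k (Suc j) x)"
    using d_d[of "Suc i" "Suc j" k x Plus Plus] assms by simp
  finally show ?thesis
    using mod_hom_diff[OF module_C module_C hj assms(4) sdx] by (simp add: proj_def)
qed

text \<open>Every factor has index above \<open>j\<close>, so \<open>proj_s_less\<close> pulls
  \<open>s_j\<close> out of it, altering only the argument. The exact argument is irrelevant for
  \<open>eta_s\<close>, hence the existential form.\<close>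

lemma eta_from_s:
  assumes "1 \<le> j" "j < a" "z \<in> carrier (C (k - 1))"
  shows "\<exists>z'\<in>carrier (C (k - 1)). eta_from k a (s (k - 1) j z) = s (k - 1) j z'"
  using assms(2)
proof (induction "k - a" arbitrary: a)
  case 0
  then show ?case using assms by (auto simp: eta_from_simps)
next
  case (Suc n)
  then obtain z' where z': "z' \<in> carrier (C (k - 1))"
    "eta_from k (Suc a) (s (k - 1) j z) = s (k - 1) j z'"
    using Suc.hyps(1)[of "Suc a"] Suc.hyps(2) Suc.prems by (metis Suc_diff_Suc Suc_inject less_SucI zero_less_Suc zero_less_diff)
  have "proj (k - 1) (a - 1) z' \<in> carrier (C (k - 1))"
    using Suc assms z'(1) by (intro mod_hom_closed[OF proj_hom]) auto
  then show ?case
    using Suc assms z' proj_s_less[of j a k z'] by (auto simp: eta_from_simps)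
qed

lemma eta_s:
  assumes "1 \<le> j" "j < k" "z \<in> carrier (C (k - 1))"
  shows "eta C d s k (s (k - 1) j z) = \<zero>\<^bsub>C k\<^esub>"
proof -
  \<comment> \<open>Downward induction from \<open>a = j\<close>: there \<open>p_j\<close> meets a
    value of \<open>s_j\<close> and kills it, and the factors further left map zero to zero.\<close>
  have "eta_from k a (s (k - 1) j z) = \<zero>\<^bsub>C k\<^esub>" if "a \<le> j" "1 \<le> a" for a
    using that
  proof (induction a rule: inc_induct)
    case base
    obtain z' where "z' \<in> carrier (C (k - 1))"
      "eta_from k (Suc j) (s (k - 1) j z) = s (k - 1) j z'"
      using eta_from_s[of j "Suc j" z k] assms by auto
    then show ?case using assms proj_s_same[of j k z'] by (simp add: eta_from_simps)
  next
    case (step a)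
    then show ?case
      using assms mod_hom_zero[OF module_C module_C proj_hom[of a k]] by (simp add: eta_from_simps)
  qed
  from this[of 1] show ?thesis using assms by (simp add: eta_eq)
qed

lemma d_eta:
  assumes "2 \<le> j" "j \<le> k" "x \<in> carrier (C k)"
  shows "d Plus k j (eta C d s k x) = \<zero>\<^bsub>C (k - 1)\<^esub>"
proof -
  obtain i where i: "j = Suc i" "1 \<le> i" "i < k"
    using assms by (cases j) auto
  \<comment> \<open>Downward induction from \<open>a = i\<close>: there the outermost factor is
    \<open>p_i\<close>, whose values \<open>d^+_(i+1)\<close> kills; the face commutes with every
    factor further left.\<close>
  have "d Plus k (Suc i) (eta_from k a x) = \<zero>\<^bsub>C (k - 1)\<^esub>" if "a \<le> i" "1 \<le> a" for a
    using that
  proof (induction a rule: inc_induct)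
    case base
    then show ?case
      using i assms d_proj_same[of i k] eta_from_closed[of "Suc i" x k]
      by (simp add: eta_from_simps)
  next
    case (step a)
    then have "d Plus k (Suc i) (eta_from k a x) = proj (k - 1) a (d Plus k (Suc i) (eta_from k (Suc a) x))"
      using i assms d_proj_less[of a i k] eta_from_closed[of "Suc a" x k]
      by (simp add: eta_from_simps)
    also have "\<dots> = \<zero>\<^bsub>C (k - 1)\<^esub>"
      using step i mod_hom_zero[OF module_C module_C proj_hom[of a "k - 1"]] by simp
    finally show ?case .
  qed
  from this[of 1] show ?thesis using i by (simp add: eta_eq)
qed

text \<open>Each factor \<open>p_i\<close> subtracts \<open>s_i\<close> of a vanishing face, so it
  fixes \<open>x\<close>.\<close>

lemma eta_fixed:
  assumes "\<And>j. 2 \<le> j \<Longrightarrow> j \<le> k \<Longrightarrow> d Plus k j x = \<zero>\<^bsub>C (k - 1)\<^esub>" "x \<in> carrier (C k)"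
  shows "eta C d s k x = x"
proof -
  have p: "proj k i x = x" if "1 \<le> i" "i < k" for i
    using assms that mod_hom_zero[OF module_C module_C s_hom_pred[of i k]]
    by (simp add: proj_def a_minus_def)
  have "eta_from k a x = x" if "1 \<le> a" for a
    using that
  proof (induction "k - a" arbitrary: a)
    case (Suc n)
    then show ?case using p by (simp add: eta_from_simps)
  qed (simp add: eta_from_simps)
  then show ?thesis by (simp add: eta_eq)
qed

text \<open>\<open>d_eta\<close> gives one inclusion and \<open>eta_fixed\<close> the other. The
  kernel description can be tested on a boundary, which the definition as an image does not directly
  allow.\<close>

lemma normalized_part_eq:
  "normalized_part C d s k =
    {x \<in> carrier (C k). \<forall>j. 2 \<le> j \<longrightarrow> j \<le> k \<longrightarrow> d Plus k j x = \<zero>\<^bsub>C (k - 1)\<^esub>}"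
  unfolding normalized_part_def
proof (intro equalityI subsetI)
  fix x assume "x \<in> eta C d s k ` carrier (C k)"
  then show "x \<in> {x \<in> carrier (C k). \<forall>j. 2 \<le> j \<longrightarrow> j \<le> k \<longrightarrow> d Plus k j x = \<zero>\<^bsub>C (k - 1)\<^esub>}"
    using d_eta eta_from_closed[of 1] by (auto simp: eta_eq)
next
  fix x assume "x \<in> {x \<in> carrier (C k). \<forall>j. 2 \<le> j \<longrightarrow> j \<le> k \<longrightarrow> d Plus k j x = \<zero>\<^bsub>C (k - 1)\<^esub>}"
  then have "x \<in> carrier (C k)" "eta C d s k x = x"
    using eta_fixed[of k x] by auto
  then show "x \<in> eta C d s k ` carrier (C k)" by force
qed

text \<open>Telescoping: with \<open>y\<close> the value of the shorter product,
  \<open>x - p_a y = (x - y) + s_a d^+_(a+1) y\<close>, so each new factor adds one degenerate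
  term.\<close>

lemma minus_eta_in_degenerate_part:
  assumes "x \<in> carrier (C k)"
  shows "x \<ominus>\<^bsub>C k\<^esub> eta C d s k x \<in> degenerate_part C s k"
proof -
  note D = C.submoduleE[OF submodule_degenerate_part[of k]]
  have "x \<ominus>\<^bsub>C k\<^esub> eta_from k a x \<in> degenerate_part C s k" if "1 \<le> a" for a
    using that
  proof (induction "k - a" arbitrary: a)
    case 0
    then show ?case
      using assms submodule_zero_closed[OF module_C submodule_degenerate_part]
      by (simp add: eta_from_simps a_minus_def C.M.r_neg)
  next
    case (Suc n)
    let ?y = "eta_from k (Suc a) x"
    let ?t = "s (k - 1) a (d Plus k (Suc a) ?y)"
    have y: "?y \<in> carrier (C k)" using assms by (intro eta_from_closed) auto
    have t: "?t \<in> degenerate_part C s k"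
      using Suc y by (intro s_in_degenerate_part d_closed) auto
    have "x \<ominus>\<^bsub>C k\<^esub> eta_from k a x = (x \<ominus>\<^bsub>C k\<^esub> ?y) \<oplus>\<^bsub>C k\<^esub> ?t"
      using Suc assms y t D(1)
      by (simp add: eta_from_simps proj_def a_minus_def C.M.minus_add C.M.a_assoc subset_iff)
    then show ?case using Suc t by (simp add: D)
  qed
  from this[of 1] show ?thesis by (simp add: eta_eq)
qed

lemma direct_sum_decomposition_degenerate_normalized:
  "direct_sum_decomposition R (C k) (degenerate_part C s k) (normalized_part C d s k)"
proof -
  let ?D = "degenerate_part C s k" and ?N = "normalized_part C d s k"
  have eta: "eta C d s k \<in> mod_hom R (C k) (C k)"
    unfolding eta_eq by (rule eta_from_hom) simp
  have N: "submodule ?N R (C k)"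
    unfolding normalized_part_def by (intro mod_hom_image_submodule module_C eta)
  have D: "submodule ?D R (C k)"
    by (rule submodule_degenerate_part)
  note subD = C.submoduleE(1)[OF D] and subN = C.submoduleE(1)[OF N]
  \<comment> \<open>The map \<open>eta\<close> kills the degenerate part and fixes the normalized
    part, so an element of both is zero.\<close>
  have "?D \<subseteq> {x \<in> carrier (C k). eta C d s k x \<in> {\<zero>\<^bsub>C k\<^esub>}}"
    by (intro degenerate_part_least mod_hom_vimage_submodule[OF module_C module_C eta]
        submodule_zero module_C) (auto simp: eta_s[simplified] mod_hom_closed[OF s_hom_pred, simplified])
  moreover have "eta C d s k x = x" if "x \<in> ?N" for x
    using that eta_fixed by (simp add: normalized_part_eq)
  ultimately have "?D \<inter> ?N \<subseteq> {\<zero>\<^bsub>C k\<^esub>}" by fastforce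
  then have "?D \<inter> ?N = {\<zero>\<^bsub>C k\<^esub>}"
    using submodule_zero_closed[OF module_C D] submodule_zero_closed[OF module_C N] by blast
  moreover have "?D <+>\<^bsub>C k\<^esub> ?N = carrier (C k)"
  proof
    show "?D <+>\<^bsub>C k\<^esub> ?N \<subseteq> carrier (C k)"
      using subD subN by (auto simp: set_add_def')
    show "carrier (C k) \<subseteq> ?D <+>\<^bsub>C k\<^esub> ?N"
    proof
      fix x assume x: "x \<in> carrier (C k)"
      have ex: "eta C d s k x \<in> carrier (C k)" by (rule mod_hom_closed[OF eta x])
      have "x = (x \<ominus>\<^bsub>C k\<^esub> eta C d s k x) \<oplus>\<^bsub>C k\<^esub> eta C d s k x"
        using x ex by (simp add: a_minus_def C.M.a_assoc C.M.l_neg)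
      moreover have "eta C d s k x \<in> ?N"
        using x by (simp add: normalized_part_def)
      ultimately show "x \<in> ?D <+>\<^bsub>C k\<^esub> ?N"
        using minus_eta_in_degenerate_part[OF x] unfolding set_add_def' by blast
    qed
  qed
  ultimately show ?thesis
    using D N by (simp add: direct_sum_decomposition_def)
qed

lemma chain_complex_splitting_degenerate_normalized:
  assumes ab: "\<alpha> \<in> carrier R" "\<beta> \<in> carrier R"
  shows "chain_complex_splitting R C (total_boundary R C d \<alpha> \<beta>)
    (degenerate_part C s) (normalized_part C d s)"
  unfolding chain_complex_splitting_def
proof (intro conjI allI)
  show "subcomplex R C (total_boundary R C d \<alpha> \<beta>) (degenerate_part C s)"
    by (rule subcomplex_degenerate_part[OF ab])
  show dec: "direct_sum_decomposition R (C k) (degenerate_part C s k) (normalized_part C d s k)" for k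
    by (rule direct_sum_decomposition_degenerate_normalized)
  have "total_boundary R C d \<alpha> \<beta> k x \<in> normalized_part C d s (k - 1)"
    if k: "1 \<le> k" and x: "x \<in> normalized_part C d s k" for k x
  proof -
    have xc: "x \<in> carrier (C k)" using x by (simp add: normalized_part_eq)
    \<comment> \<open>These are exactly the faces that define the normalized part in degree
      \<open>k - 1\<close>.\<close>
    have "d Plus (k - 1) j (partial_boundary \<alpha> \<beta> k k x) = \<zero>\<^bsub>C (k - 1 - 1)\<^esub>"
      if "2 \<le> j" "j \<le> k - 1" for j
      using partial_boundary_annihilated[OF ab, of k x j k] x that
      by (simp add: normalized_part_eq numeral_2_eq_2)
    then show ?thesis
      using partial_boundary_closed[OF ab, of k k x] xc k
      by (simp add: normalized_part_eq total_boundary_eq[OF ab k xc])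
  qed
  then show "subcomplex R C (total_boundary R C d \<alpha> \<beta>) (normalized_part C d s)"
    using chain_complex_total_boundary[OF ab] dec
    by (auto simp: subcomplex_def direct_sum_decomposition_def)
qed

end

theorem theorem2p2:
  fixes R :: "('r, 'p) ring_scheme"
    and C :: "nat \<Rightarrow> ('r, 'a, 'm) module_scheme"
    and d :: "sign \<Rightarrow> nat \<Rightarrow> nat \<Rightarrow> 'a \<Rightarrow> 'a"
  assumes "cring R"
    and "pre_cubical_module R C d"
  shows "(\<forall>\<alpha>\<in>carrier R. \<forall>\<beta>\<in>carrier R. chain_complex R C (total_boundary R C d \<alpha> \<beta>)) \<and>
    (\<forall>s. weak_skew_cubical_module R C d s \<longrightarrow>
      (\<forall>\<alpha>\<in>carrier R. \<forall>\<beta>\<in>carrier R.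
        subcomplex R C (total_boundary R C d \<alpha> \<beta>) (degenerate_part C s))) \<and>
    (\<forall>s. semi_strong_skew_cubical_module R C d s \<longrightarrow>
      (\<forall>k. direct_sum_decomposition R (C k) (degenerate_part C s k) (normalized_part C d s k)) \<and>
      (\<forall>\<alpha>\<in>carrier R. \<forall>\<beta>\<in>carrier R.
        chain_complex_splitting R C (total_boundary R C d \<alpha> \<beta>)
          (degenerate_part C s) (normalized_part C d s)))"
  using assms(2)
  by (blast intro: pre_cubical_module.chain_complex_total_boundary
      weak_skew_cubical_module.subcomplex_degenerate_part
      semi_strong_skew_cubical_module.direct_sum_decomposition_degenerate_normalized
      semi_strong_skew_cubical_module.chain_complex_splitting_degenerate_normalized)

end
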